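(* Let $n\ge 2$ and $k$ be integers with $1\le k\le n-1$ and $n\neq 2k$, and let $P_n$ be the path graph on $\{1,\dots,n\}$ with edges $\{i,i+1\}$, $1\le i\le n-1$. Then every automorphism of the $k$-token graph $F_k(P_n)$ is induced by an automorphism of $P_n$; that is, for every $f\in\mathrm{Aut}(F_k(P_n))$ there is $\theta\in\mathrm{Aut}(P_n)$ with $f(\{a_1,\dots,a_k\})=\{\theta(a_1),\dots,\theta(a_k)\}$ for all vertices $\{a_1,\dots,a_k\}$. Equivalently, $\mathrm{Aut}(F_k(P_n))=\mathrm{Aut}(P_n)$ (so $|\mathrm{Aut}(F_k(P_n))|=2$).
   Context: All graphs are finite and simple. For a graph $\Gamma$ of order $n$ and an integer $1\le k\le n-1$, the $k$-token graph $F_k(\Gamma)$ has as vertices all $k$-element subsets of $V(\Gamma)$, two of them $A,B$ being adjacent iff their symmetric difference $A\triangle B$ is an edge of $\Gamma$. Each $\theta\in\mathrm{Aut}(\Gamma)$ induces the automorphism $A\mapsto\theta(A)$ of $F_k(\Gamma)$; writing $\mathrm{Aut}(F_k(\Gamma))=\mathrm{Aut}(\Gamma)$ means every automorphism of $F_k(\Gamma)$ arises this way. *)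

theory Defs
  imports Main "HOL-Combinatorics.Permutations"
begin

record 'a ugraph =
  verts :: "'a set"
  edges :: "'a set set"

definition simple_graph :: "'a ugraph \<Rightarrow> bool" where
  "simple_graph G \<longleftrightarrow> finite (verts G) \<and> (\<forall>e\<in>edges G. e \<subseteq> verts G \<and> card e = 2)"

text \<open>Automorphisms are total functions that are the identity off the vertex set (\<open>permutes\<close>),
  so that distinct elements of \<open>Aut G\<close> differ on a vertex and \<open>card (Aut G)\<close> is the order
  of the automorphism group.\<close>

definition Aut :: "'a ugraph \<Rightarrow> ('a \<Rightarrow> 'a) set" where
  "Aut G = {f. f permutes verts G \<and>
     (\<forall>u\<in>verts G. \<forall>v\<in>verts G. {f u, f v} \<in> edges G \<longleftrightarrow> {u, v} \<in> edges G)}"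

definition token_graph :: "nat \<Rightarrow> 'a ugraph \<Rightarrow> 'a set ugraph" where
  "token_graph k G =
     \<lparr> verts = {A. A \<subseteq> verts G \<and> card A = k},
       edges = {{A, B} | A B. A \<subseteq> verts G \<and> card A = k \<and> B \<subseteq> verts G \<and> card B = k \<and>
                  sym_diff A B \<in> edges G} \<rparr>"

definition induced_map :: "nat \<Rightarrow> 'a ugraph \<Rightarrow> ('a \<Rightarrow> 'a) \<Rightarrow> ('a set \<Rightarrow> 'a set)" where
  "induced_map k G \<theta> = (\<lambda>A. if A \<in> verts (token_graph k G) then \<theta> ` A else A)"

definition path_graph :: "nat \<Rightarrow> nat ugraph" where
  "path_graph n = \<lparr> verts = {1..n}, edges = {{i, i + 1} | i. 1 \<le> i \<and> i \<le> n - 1} \<rparr>"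

lemma simple_graph_path_graph: "simple_graph (path_graph n)"
  by (auto simp: simple_graph_def path_graph_def)

lemma simple_graph_token_graph:
  assumes "simple_graph G"
  shows "simple_graph (token_graph k G)"
proof -
  have "card {A, B} = 2" if "sym_diff A B \<in> edges G" for A B
  proof -
    have "A \<noteq> B"
      using that assms by (auto simp: simple_graph_def)
    then show ?thesis by simp
  qed
  moreover have "finite {A. A \<subseteq> verts G \<and> card A = k}"
    using assms by (auto simp: simple_graph_def)
  ultimately show ?thesis
    by (auto simp: simple_graph_def token_graph_def)
qed

end

theory Submission
  imports Defs
begin

text \<open>
  Call moving one token from \<open>i\<close> to \<open>i + 1\<close> an up-move. The token graph of the path is the Hasse
  diagram of the up-moves, graded by the sum of the tokens; it is the distributive lattice of Young
  diagrams in a \<open>k \<times> (n - k)\<close> box. Its only vertices of degree one are the bottom \<open>{1..k}\<close> and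
  the top, so after composing with the reflection of the path an automorphism fixes the bottom.
  It then preserves ranks, hence the direction of the up-moves.

  Let \<open>A\<close> be moved with minimal rank. All lower covers of \<open>A\<close> are fixed, so \<open>A\<close> and its image
  have the same lower covers. As two elements have at most one common upper cover, there is just one
  lower cover, and the two diagrams are rectangles that arise from the same diagram by adding a
  cell: they are \<open>1 \<times> 2\<close> and \<open>2 \<times> 1\<close>. Climbing further, the row \<open>1 \<times> b\<close> must be mapped to the
  column \<open>b \<times> 1\<close> as long as both fit. At \<open>b = min k (n - k)\<close> exactly one of them has reached
  the border of the box and has fewer upper covers than the other; this is where \<open>n \<noteq> 2 * k\<close> is used.
\<close>

section \<open>Edges, automorphisms and induced maps\<close>

abbreviation token_path :: "nat \<Rightarrow> nat \<Rightarrow> nat set ugraph" where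
  "token_path n k \<equiv> token_graph k (path_graph n)"

text \<open>The right end of the path is left out on purpose: where it matters, membership of the
  target in the vertex set supplies the bound. The condition \<open>i \<ge> 1\<close> keeps lower
  covers of vertices inside the vertex set, see \<open>up_in_verts\<close>.\<close>

definition up :: "nat set \<Rightarrow> nat set \<Rightarrow> bool" where
  "up A B \<longleftrightarrow> (\<exists>i\<ge>1. i \<in> A \<and> Suc i \<notin> A \<and> B = insert (Suc i) (A - {i}))"

lemma edge_token_graph_iff:
  "{A, B} \<in> edges (token_graph k G) \<longleftrightarrow>
     A \<in> verts (token_graph k G) \<and> B \<in> verts (token_graph k G) \<and> sym_diff A B \<in> edges G"
  by (auto simp: token_graph_def doubleton_eq_iff Un_commute)

lemma edge_path_graph_iff:
  "{u, v} \<in> edges (path_graph n) \<longleftrightarrow>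
     1 \<le> u \<and> u \<le> n \<and> 1 \<le> v \<and> v \<le> n \<and> (v = Suc u \<or> u = Suc v)"
  by (auto simp: path_graph_def doubleton_eq_iff)

lemma verts_token_path: "A \<in> verts (token_path n k) \<longleftrightarrow> A \<subseteq> {1..n} \<and> card A = k"
  by (auto simp: token_graph_def path_graph_def)

lemma finite_token_path: "A \<in> verts (token_path n k) \<Longrightarrow> finite A"
  using finite_subset[of A "{1..n}"] by (auto simp: verts_token_path)

lemma Aut_mem_iff: "f \<in> Aut G \<Longrightarrow> f A \<in> verts G \<longleftrightarrow> A \<in> verts G"
  by (auto simp: Aut_def permutes_in_image)

lemma Aut_edge_iff:
  "f \<in> Aut G \<Longrightarrow> u \<in> verts G \<Longrightarrow> v \<in> verts G \<Longrightarrow> {f u, f v} \<in> edges G \<longleftrightarrow> {u, v} \<in> edges G"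
  by (auto simp: Aut_def)

lemma Aut_inv_f: "f \<in> Aut G \<Longrightarrow> inv f (f A) = A" "f \<in> Aut G \<Longrightarrow> f (inv f A) = A"
  by (auto simp: Aut_def permutes_inverses)

lemma Aut_inv:
  assumes "f \<in> Aut G"
  shows "inv f \<in> Aut G"
proof -
  have p: "inv f permutes verts G" using assms by (simp add: Aut_def permutes_inv)
  have "{inv f u, inv f v} \<in> edges G \<longleftrightarrow> {u, v} \<in> edges G" if "u \<in> verts G" "v \<in> verts G" for u v
    using Aut_edge_iff[OF assms, of "inv f u" "inv f v"] that
    by (simp add: permutes_in_image[OF p] Aut_inv_f[OF assms])
  with p show ?thesis by (simp add: Aut_def)
qed

lemma Aut_comp: "f \<in> Aut G \<Longrightarrow> g \<in> Aut G \<Longrightarrow> f \<circ> g \<in> Aut G"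
  by (auto simp: Aut_def permutes_compose permutes_in_image)

lemma id_in_Aut: "id \<in> Aut G"
  by (simp add: Aut_def permutes_id)

lemma induced_map_in_Aut:
  assumes G: "simple_graph G" and t: "\<theta> \<in> Aut G"
  shows "induced_map k G \<theta> \<in> Aut (token_graph k G)"
proof -
  let ?V = "verts (token_graph k G)" and ?h = "induced_map k G \<theta>"
  have V: "A \<in> ?V \<longleftrightarrow> A \<subseteq> verts G \<and> card A = k" for A
    by (simp add: token_graph_def)
  have p: "\<theta> permutes verts G" using t by (simp add: Aut_def)
  have inj: "inj \<theta>" using p by (rule permutes_inj)
  have im: "\<theta> ` A \<in> ?V" if "A \<in> ?V" for A
    using that permutes_in_image[OF p] inj by (auto simp: V card_image inj_on_def)
  have "finite ?V" using simple_graph_token_graph[OF G] by (simp add: simple_graph_def)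
  moreover have "inj_on ?h ?V"
    by (auto simp: inj_on_def induced_map_def inj_image_eq_iff[OF inj])
  moreover have "?h ` ?V \<subseteq> ?V"
    using im by (auto simp: induced_map_def)
  ultimately have "bij_betw ?h ?V ?V"
    by (simp add: bij_betw_def endo_inj_surj)
  then have perm: "?h permutes ?V"
    by (rule bij_imp_permutes) (simp add: induced_map_def)
  \<comment> \<open>\<open>Aut\<close> only speaks of pairs. Sets of any other size are not edges of
    a simple graph, and the injective \<open>\<theta>\<close> preserves size.\<close>
  have edge: "\<theta> ` S \<in> edges G \<longleftrightarrow> S \<in> edges G" if S: "S \<subseteq> verts G" for S
  proof (cases "card S = 2")
    case True
    then obtain u v where "S = {u, v}" by (auto simp: card_2_iff)
    then show ?thesis using Aut_edge_iff[OF t, of u v] S by simp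
  next
    case False
    moreover have "card (\<theta> ` S) = card S" using inj by (simp add: card_image inj_on_def)
    ultimately show ?thesis using G unfolding simple_graph_def by metis
  qed
  have "{?h A, ?h B} \<in> edges (token_graph k G) \<longleftrightarrow> {A, B} \<in> edges (token_graph k G)"
    if AB: "A \<in> ?V" "B \<in> ?V" for A B
  proof -
    have "sym_diff (\<theta> ` A) (\<theta> ` B) = \<theta> ` sym_diff A B"
      by (simp add: image_Un image_set_diff[OF inj])
    moreover have "sym_diff A B \<subseteq> verts G" using AB by (auto simp: V)
    ultimately show ?thesis using AB im edge
      by (simp add: edge_token_graph_iff induced_map_def)
  qed
  with perm show ?thesis by (simp add: Aut_def)
qed

section \<open>Up-moves and the token sum as rank\<close>

lemma up_in_verts:
  assumes "up C A" "A \<in> verts (token_path n k)"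
  shows "C \<in> verts (token_path n k)"
proof -
  obtain i where i: "i \<ge> 1" "i \<in> C" "Suc i \<notin> C" "A = insert (Suc i) (C - {i})"
    using assms(1) by (auto simp: up_def)
  have C: "C = insert i (A - {Suc i})" using i by auto
  have "finite A" using assms(2) by (rule finite_token_path)
  moreover have "Suc i \<in> A" "i \<notin> A" using i by auto
  ultimately have "card C = card A" unfolding C
    by (simp add: card_Suc_Diff1 del: card_Diff_insert)
  moreover have "C \<subseteq> {1..n}" using C i assms(2) by (auto simp: verts_token_path)
  ultimately show ?thesis using assms(2) by (simp add: verts_token_path)
qed

lemma upI:
  assumes "A \<in> verts (token_path n k)" "i \<in> A" "Suc i \<notin> A" "Suc i \<le> n"
  shows "up A (insert (Suc i) (A - {i}))" "insert (Suc i) (A - {i}) \<in> verts (token_path n k)"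
proof -
  have i: "i \<ge> 1" using assms by (auto simp: verts_token_path)
  then show "up A (insert (Suc i) (A - {i}))" using assms by (auto simp: up_def)
  have "finite A" using assms(1) by (rule finite_token_path)
  then have "card (insert (Suc i) (A - {i})) = card A" using assms
    by (simp add: card_Suc_Diff1 del: card_Diff_insert)
  then show "insert (Suc i) (A - {i}) \<in> verts (token_path n k)"
    using assms i by (auto simp: verts_token_path)
qed

lemma downI:
  assumes "Suc i \<in> A" "i \<notin> A" "i \<ge> 1"
  shows "up (insert i (A - {Suc i})) A"
  unfolding up_def using assms by (intro exI[of _ i]) auto

lemma sum_up:
  assumes "up A B" "finite A"
  shows "\<Sum>B = Suc (\<Sum>A)"
proof -
  obtain i where i: "i \<in> A" "Suc i \<notin> A" "B = insert (Suc i) (A - {i})"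
    using assms by (auto simp: up_def)
  have "\<Sum>A = i + \<Sum>(A - {i})" using i assms by (simp add: sum.remove)
  then show ?thesis using i assms by simp
qed

text \<open>Sets of equal size differ by equally many elements on both sides. So a symmetric
  difference \<open>{i, Suc i}\<close> has one element on each side, and the side of
  \<open>i\<close> decides the direction of the move.\<close>

lemma edge_token_path_iff:
  assumes "A \<in> verts (token_path n k)" "B \<in> verts (token_path n k)"
  shows "{A, B} \<in> edges (token_path n k) \<longleftrightarrow> up A B \<or> up B A"
proof
  assume "{A, B} \<in> edges (token_path n k)"
  then obtain i where i: "1 \<le> i" "sym_diff A B = {i, Suc i}"
    unfolding edge_token_graph_iff by (auto simp: path_graph_def)
  have fin: "finite A" "finite B" using assms finite_token_path by auto
  have "card (A - B) = card (B - A)"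
  proof -
    have "card A = card (A - B) + card (A \<inter> B)" "card B = card (B - A) + card (A \<inter> B)"
      using fin card_Int_Diff[of A B] card_Int_Diff[of B A] by (auto simp: Int_commute)
    then show ?thesis using assms by (auto simp: verts_token_path)
  qed
  moreover have "card {i, Suc i} = card (A - B) + card (B - A)"
    using fin unfolding i(2)[symmetric] by (intro card_Un_disjoint) auto
  ultimately have one: "card (A - B) = 1" "card (B - A) = 1" by auto
  then obtain x y where xy: "A - B = {x}" "B - A = {y}"
    by (meson card_1_singletonE)
  then have "{x, y} = {i, Suc i}" using i by auto
  then consider "x = i" "y = Suc i" | "x = Suc i" "y = i" by (auto simp: doubleton_eq_iff)
  then show "up A B \<or> up B A"
  proof cases
    case 1
    then have "i \<in> A" "Suc i \<notin> A" "B = insert (Suc i) (A - {i})" using xy by auto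
    then show ?thesis using i by (auto simp: up_def)
  next
    case 2
    then have "i \<in> B" "Suc i \<notin> B" "A = insert (Suc i) (B - {i})" using xy by auto
    then show ?thesis using i by (auto simp: up_def)
  qed
next
  have *: "sym_diff C D \<in> edges (path_graph n)" if CD: "up C D" "D \<in> verts (token_path n k)" for C D
  proof -
    obtain i where i: "i \<ge> 1" "i \<in> C" "Suc i \<notin> C" "D = insert (Suc i) (C - {i})"
      using CD(1) by (auto simp: up_def)
    then have "sym_diff C D = {i, i + 1}" by auto
    moreover have "Suc i \<in> D" using i(4) by simp
    then have "Suc i \<le> n" using CD(2) by (auto simp: verts_token_path)
    then have "{i, i + 1} \<in> edges (path_graph n)" using i(1) by (simp add: edge_path_graph_iff)
    ultimately show ?thesis by simp
  qed
  assume "up A B \<or> up B A"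
  moreover have "sym_diff A B = sym_diff B A" by blast
  ultimately have "sym_diff A B \<in> edges (path_graph n)" using * assms by metis
  then show "{A, B} \<in> edges (token_path n k)"
    using assms unfolding edge_token_graph_iff by blast
qed

section \<open>Rank and direction under automorphisms fixing the bottom\<close>

text \<open>If no token has a free place of the path directly below it, then the set is closed
  downwards, hence an initial segment, and its size leaves only \<open>{1..k}\<close>.\<close>

lemma down_exists:
  assumes "A \<in> verts (token_path n k)" "A \<noteq> {1..k}"
  obtains C where "up C A"
proof -
  have "\<exists>i\<ge>1. Suc i \<in> A \<and> i \<notin> A"
  proof (rule ccontr)
    assume no: "\<not> ?thesis"
    have fin: "finite A" using assms by (auto intro: finite_token_path)
    have cl: "x - d \<in> A" if "x \<in> A" "d < x" for x d
      using that(2)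
    proof (induction d)
      case 0 then show ?case using that by simp
    next
      case (Suc d)
      then have "Suc (x - Suc d) \<in> A" by (simp add: Suc_diff_Suc)
      with no Suc show ?case by (metis One_nat_def Suc_leI zero_less_diff)
    qed
    have "A = {1..Max A}" if "A \<noteq> {}"
    proof
      show "A \<subseteq> {1..Max A}" using fin assms by (auto simp: verts_token_path)
      have "y \<in> A" if "y \<in> {1..Max A}" for y
        using cl[of "Max A" "Max A - y"] that Max_in[OF fin \<open>A \<noteq> {}\<close>] by auto
      then show "{1..Max A} \<subseteq> A" by blast
    qed
    moreover have "card A = k" using assms by (simp add: verts_token_path)
    ultimately show False using assms(2)
      by (metis card_atLeastAtMost card.empty diff_Suc_1 atLeastatMost_empty_iff One_nat_def
          less_Suc_eq_0_disj not_less zero_less_one)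
  qed
  then show thesis using downI that by blast
qed

text \<open>The induction is over all automorphisms at once: if \<open>f\<close> lowered the rank of \<open>A\<close>, the
  hypothesis for \<open>inv f\<close> would apply to \<open>f A\<close>.\<close>

lemma Aut_sum:
  assumes "f \<in> Aut (token_path n k)" "f {1..k} = {1..k}" "A \<in> verts (token_path n k)"
  shows "\<Sum>(f A) = \<Sum>A"
  using assms
proof (induction "\<Sum>A" arbitrary: f A rule: less_induct)
  case less
  show ?case
  proof (cases "A = {1..k}")
    case True then show ?thesis using less by simp
  next
    case False
    then obtain C where C: "up C A" using down_exists[OF less(4)] by metis
    have CV: "C \<in> verts (token_path n k)" using up_in_verts[OF C less(4)] .
    have sC: "\<Sum>A = Suc (\<Sum>C)" using sum_up[OF C] finite_token_path[OF CV] by blast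
    then have fC: "\<Sum>(f C) = \<Sum>C" using less(1)[OF _ less(2,3) CV] by simp
    have V: "f A \<in> verts (token_path n k)" "f C \<in> verts (token_path n k)"
      using less(4) CV Aut_mem_iff[OF less(2)] by simp_all
    have "up (f C) (f A) \<or> up (f A) (f C)"
      using C Aut_edge_iff[OF less(2) CV less(4)] edge_token_path_iff[OF CV less(4)]
        edge_token_path_iff[OF V(2,1)] by simp
    then show ?thesis
    proof
      assume "up (f C) (f A)"
      from sum_up[OF this finite_token_path[OF V(2)]] show ?thesis using fC sC by simp
    next
      assume "up (f A) (f C)"
      from sum_up[OF this finite_token_path[OF V(1)]] have "Suc (\<Sum>(f A)) = \<Sum>C" using fC by simp
      then have lt: "\<Sum>(f A) < \<Sum>A" using sC by simp
      have "inv f {1..k} = {1..k}" using less(2,3) Aut_inv_f(1) by metis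
      then have "\<Sum>(inv f (f A)) = \<Sum>(f A)"
        using less(1)[OF lt Aut_inv[OF less(2)] _ V(1)] by blast
      then show ?thesis using Aut_inv_f(1)[OF less(2)] by metis
    qed
  qed
qed

text \<open>An edge joins consecutive ranks, so rank preservation leaves only one possible direction
  for its image.\<close>

lemma Aut_up_iff:
  assumes "f \<in> Aut (token_path n k)" "f {1..k} = {1..k}"
    and A: "A \<in> verts (token_path n k)" and B: "B \<in> verts (token_path n k)"
  shows "up (f A) (f B) \<longleftrightarrow> up A B"
proof -
  have s: "\<Sum>(f A) = \<Sum>A" "\<Sum>(f B) = \<Sum>B"
    using Aut_sum[OF assms(1,2)] A B by simp_all
  have V: "f A \<in> verts (token_path n k)" "f B \<in> verts (token_path n k)"
    using A B Aut_mem_iff[OF assms(1)] by simp_all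
  have "up (f A) (f B) \<or> up (f B) (f A) \<longleftrightarrow> up A B \<or> up B A"
    using Aut_edge_iff[OF assms(1) A B] edge_token_path_iff[OF A B] edge_token_path_iff[OF V] by simp
  moreover have "Suc (\<Sum>A) = \<Sum>B" if "up A B \<or> up (f A) (f B)"
    using that sum_up[of A B] sum_up[of "f A" "f B"] s
      finite_token_path[OF A] finite_token_path[OF V(1)] by auto
  moreover have "Suc (\<Sum>B) = \<Sum>A" if "up B A \<or> up (f B) (f A)"
    using that sum_up[of B A] sum_up[of "f B" "f A"] s
      finite_token_path[OF B] finite_token_path[OF V(2)] by auto
  ultimately show ?thesis by linarith
qed

section \<open>Common covers and join-irreducible diagrams\<close>

text \<open>In the lattice the common upper cover would be the join. Concretely, a different move of
  \<open>B\<close> leaves \<open>i\<close> occupied and \<open>Suc i\<close> free, while in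
  \<open>C\<close> it is the other way round. One move of \<open>C\<close> would then have to fill
  \<open>i\<close> and vacate \<open>Suc i\<close>, which is a down-move.\<close>

lemma common_upper_cover_unique:
  assumes "up B A" "up C A" "up B A'" "up C A'" "B \<noteq> C"
  shows "A = A'"
proof -
  obtain i where i: "i \<in> B" "Suc i \<notin> B" "A = insert (Suc i) (B - {i})"
    using assms(1) by (auto simp: up_def)
  obtain j where j: "j \<in> C" "Suc j \<notin> C" "A = insert (Suc j) (C - {j})"
    using assms(2) by (auto simp: up_def)
  obtain i' where i': "i' \<in> B" "Suc i' \<notin> B" "A' = insert (Suc i') (B - {i'})"
    using assms(3) by (auto simp: up_def)
  obtain j' where j': "j' \<in> C" "Suc j' \<notin> C" "A' = insert (Suc j') (C - {j'})"
    using assms(4) by (auto simp: up_def)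
  have B: "B = insert i (A - {Suc i})" and C: "C = insert j (A - {Suc j})"
    using i j by auto
  then have ij: "i \<noteq> j" using assms(5) by auto
  have mem: "Suc i \<in> A" "i \<notin> A" by (simp_all add: i(3))
  have "i' = i"
  proof (rule ccontr)
    assume ne: "i' \<noteq> i"
    have "i \<in> A'" using i'(3) i(1) ne by simp
    moreover have "i \<notin> C" using C mem ij by simp
    ultimately have "Suc j' = i" using j'(3) by blast
    have "Suc i \<notin> A'" using i'(3) i(2) ne by simp
    moreover have "Suc i \<in> C" using C mem ij by simp
    ultimately have "j' = Suc i" using j'(3) by blast
    with \<open>Suc j' = i\<close> show False by simp
  qed
  then show ?thesis using i(3) i'(3) by simp
qed

text \<open>The token sets of the diagrams \<open>1 \<times> b\<close> and \<open>b \<times> 1\<close>, the latter for \<open>b \<le> k\<close>.\<close>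

definition row_set :: "nat \<Rightarrow> nat \<Rightarrow> nat set" where
  "row_set k b = insert (k + b) {1..<k}"

definition col_set :: "nat \<Rightarrow> nat \<Rightarrow> nat set" where
  "col_set k b = {1..Suc k} - {Suc k - b}"

text \<open>Lower covers correspond to gaps directly below a token, so \<open>A\<close> has such a
  gap only at \<open>i\<close> and \<open>A'\<close> only at \<open>j\<close>. Comparing both with
  \<open>B\<close> determines \<open>B\<close> completely: it is the one-cell diagram.\<close>

lemma join_irreducible_pair_aux:
  assumes B: "B \<in> verts (token_path n k)"
    and i: "i \<in> B" "Suc i \<notin> B" "A = insert (Suc i) (B - {i})"
    and j: "j \<in> B" "Suc j \<notin> B" "A' = insert (Suc j) (B - {j})"
    and u: "\<And>C D. up C A \<Longrightarrow> up D A \<Longrightarrow> C = D"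
    and u': "\<And>C D. up C A' \<Longrightarrow> up D A' \<Longrightarrow> C = D"
    and ij: "i < j"
  shows "A = col_set k 2 \<and> A' = row_set k 2 \<and> k \<ge> 2"
proof -
  have i1: "i \<ge> 1" using i B by (auto simp: verts_token_path)
  \<comment> \<open>Two gaps below tokens give two lower covers; if these coincide, so do the
    gaps.\<close>
  have uniq: "x = y" if D: "\<And>C D. up C E \<Longrightarrow> up D E \<Longrightarrow> C = D"
      and xy: "Suc x \<in> E" "x \<notin> E" "x \<ge> 1" "Suc y \<in> E" "y \<notin> E" "y \<ge> 1" for x y E
  proof -
    have "insert x (E - {Suc x}) = insert y (E - {Suc y})"
      using D downI xy by blast
    then show ?thesis using xy by blast
  qed
  have A1: "x = i" if "Suc x \<in> A" "x \<notin> A" "x \<ge> 1" for x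
    using uniq[OF u, of A, OF _ _ that, of i] i i1 by auto
  have A2: "x = j" if "Suc x \<in> A'" "x \<notin> A'" "x \<ge> 1" for x
    using uniq[OF u', of A', OF _ _ that, of j] j ij by auto
  \<comment> \<open>Were \<open>j\<close> larger, \<open>A\<close> having no further gap would put
    tokens of \<open>B\<close> on all places from \<open>i + 2\<close> to \<open>j\<close>. The
    token at \<open>i + 2\<close> would then stay in \<open>A'\<close> above the free place
    \<open>i + 1\<close>, a second gap besides \<open>j\<close>.\<close>
  have j2: "j = Suc (Suc i)"
  proof (rule ccontr)
    assume "j \<noteq> Suc (Suc i)"
    moreover have "j \<noteq> Suc i" using i j by auto
    ultimately have j3: "j > Suc (Suc i)" using ij by simp
    have run: "j - d \<in> B" if "d < j - Suc i" for d
      using that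
    proof (induction d)
      case 0 then show ?case using j by simp
    next
      case (Suc d)
      then have "j - d \<in> A" using i ij by auto
      moreover have "j - d = Suc (j - Suc d)" using Suc by simp
      ultimately have "j - Suc d \<in> A" using A1[of "j - Suc d"] Suc by force
      then show ?case using i Suc by auto
    qed
    have "Suc (Suc i) \<in> B" using run[of "j - Suc (Suc i)"] j3 by simp
    then have "Suc i = j" using A2[of "Suc i"] i j j3 by auto
    then show False using j3 by simp
  qed
  \<comment> \<open>A free place below \<open>i\<close> would give \<open>A'\<close> a second gap;
    likewise a token beyond \<open>j\<close> would give one to \<open>A\<close>.\<close>
  have low: "i - d \<in> B" if "d < i" for d
    using that
  proof (induction d)
    case 0 then show ?case using i by simp
  next
    case (Suc d)
    then have "Suc (i - Suc d) \<in> A'" using j ij by (auto simp: Suc_diff_Suc)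
    then have "i - Suc d \<in> A'" using A2[of "i - Suc d"] Suc ij by force
    then show ?case using j Suc ij by auto
  qed
  have high: "x \<notin> B" if "x \<ge> Suc j" for x
    using that
  proof (induction x rule: dec_induct)
    case base then show ?case using j by simp
  next
    case (step x)
    show ?case
    proof
      assume "Suc x \<in> B"
      then have "x = i" using A1[of x] i step ij by auto
      then show False using step ij by simp
    qed
  qed
  have "B = insert (Suc (Suc i)) {1..i}"
  proof
    show "B \<subseteq> insert (Suc (Suc i)) {1..i}"
    proof
      fix x assume x: "x \<in> B"
      then have "x \<ge> 1" "x \<noteq> Suc i" "\<not> x \<ge> Suc j" using B i high by (auto simp: verts_token_path)
      then show "x \<in> insert (Suc (Suc i)) {1..i}" using j2 by auto
    qed
    have "y \<in> B" if "1 \<le> y" "y \<le> i" for y using low[of "i - y"] that by simp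
    then show "insert (Suc (Suc i)) {1..i} \<subseteq> B" using j j2 by auto
  qed
  moreover from this have "k = Suc i" using B by (auto simp: verts_token_path)
  ultimately show ?thesis using i i1 j j2 by (auto simp: col_set_def row_set_def)
qed

lemma join_irreducible_pair:
  assumes "up B A" "up B A'" "A \<noteq> A'" "A \<in> verts (token_path n k)"
    and u: "\<And>C D. up C A \<Longrightarrow> up D A \<Longrightarrow> C = D"
    and u': "\<And>C D. up C A' \<Longrightarrow> up D A' \<Longrightarrow> C = D"
  shows "k \<ge> 2 \<and> (A = row_set k 2 \<and> A' = col_set k 2 \<or> A = col_set k 2 \<and> A' = row_set k 2)"
proof -
  have B: "B \<in> verts (token_path n k)" using up_in_verts assms by blast
  obtain i where i: "i \<in> B" "Suc i \<notin> B" "A = insert (Suc i) (B - {i})"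
    using assms(1) by (auto simp: up_def)
  obtain j where j: "j \<in> B" "Suc j \<notin> B" "A' = insert (Suc j) (B - {j})"
    using assms(2) by (auto simp: up_def)
  have "i \<noteq> j" using i j assms by auto
  then consider "i < j" | "j < i" by linarith
  then show ?thesis
  proof cases
    case 1 then show ?thesis using join_irreducible_pair_aux[OF B i j u u'] by blast
  next
    case 2 then show ?thesis using join_irreducible_pair_aux[OF B j i u' u] by blast
  qed
qed

section \<open>Covers of rows and columns\<close>

lemma row_set_in_verts: "1 \<le> k \<Longrightarrow> k + b \<le> n \<Longrightarrow> row_set k b \<in> verts (token_path n k)"
  by (auto simp: verts_token_path row_set_def)

lemma up_row_set: "1 \<le> k \<Longrightarrow> up (row_set k b) (row_set k (Suc b))"
  unfolding up_def by (intro exI[of _ "k + b"]) (auto simp: row_set_def)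

text \<open>Only the last token of a nonempty row has a free place directly below it.\<close>

lemma up_row_set_unique:
  assumes "up C (row_set k (Suc b))"
  shows "C = row_set k b"
proof -
  obtain i where i: "i \<ge> 1" "i \<in> C" "Suc i \<notin> C" "row_set k (Suc b) = insert (Suc i) (C - {i})"
    using assms by (auto simp: up_def)
  have C: "C = insert i (row_set k (Suc b) - {Suc i})" using i by auto
  have "Suc i \<in> row_set k (Suc b)" "i \<notin> row_set k (Suc b)" using i(4) by auto
  then have "i = k + b" using i(1) by (auto simp: row_set_def)
  then show ?thesis using C by (auto simp: row_set_def)
qed

text \<open>Only the token just below the gap and the last token can move. The former lengthens the
  column and exists only for \<open>b < k\<close>; the latter adds a cell to the first row.\<close>

lemma up_col_setE:
  assumes "up (col_set k b) E" "b \<ge> 1" "b \<le> k"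
  obtains "b < k" "E = col_set k (Suc b)" | "E = insert (k + 2) (col_set k b - {Suc k})"
proof -
  obtain i where i: "i \<ge> 1" "i \<in> col_set k b" "Suc i \<notin> col_set k b"
      "E = insert (Suc i) (col_set k b - {i})"
    using assms(1) by (auto simp: up_def)
  then have "i = k - b \<or> i = Suc k" by (auto simp: col_set_def)
  then show thesis
  proof
    assume "i = k - b"
    then have "b < k" "E = col_set k (Suc b)" using i assms by (auto simp: col_set_def)
    then show thesis by (rule that(1))
  next
    assume "i = Suc k"
    then show thesis using i that(2) by simp
  qed
qed

section \<open>Automorphisms fixing the bottom are trivial\<close>

lemma Aut_bottom_row_not_to_col:
  assumes f: "f \<in> Aut (token_path n k)" "f {1..k} = {1..k}"
    and k: "2 \<le> k" "k + 2 \<le> n" "n \<noteq> 2 * k"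
    and swap: "f (row_set k 2) = col_set k 2"
  shows False
proof -
  let ?V = "verts (token_path n k)" and ?g = "inv f"
  have g: "?g \<in> Aut (token_path n k)" "?g {1..k} = {1..k}"
    using Aut_inv[OF f(1)] Aut_inv_f(1)[OF f(1), of "{1..k}"] f(2) by simp_all
  have mem: "f A \<in> ?V \<longleftrightarrow> A \<in> ?V" "?g A \<in> ?V \<longleftrightarrow> A \<in> ?V" for A
    using Aut_mem_iff[OF f(1)] Aut_mem_iff[OF g(1)] by simp_all
  note fg = Aut_inv_f[OF f(1)] and up_f = Aut_up_iff[OF f] and up_g = Aut_up_iff[OF g]
  have row: "f (row_set k b) = col_set k b" if "2 \<le> b" "b \<le> k" "k + b \<le> n" for b
    using that
  proof (induction b rule: dec_induct)
    case base
    show ?case by (rule swap)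
  next
    case (step b)
    let ?R = "row_set k (Suc b)"
    have b: "2 \<le> b" "b < k" using step.hyps step.prems by auto
    have RV: "?R \<in> ?V" "row_set k b \<in> ?V" using row_set_in_verts step k by simp_all
    have "up (f (row_set k b)) (f ?R)" using up_row_set[of k b] up_f RV k by simp
    then have "up (col_set k b) (f ?R)" using step by simp
    then show ?case
    proof (rule up_col_setE)
      \<comment> \<open>This hook has two lower covers: its last token can step back, and since
        \<open>b \<ge> 2\<close> so can the token just above the gap. But it is the image of a row,
        which has only one.\<close>
      assume E: "f ?R = insert (k + 2) (col_set k b - {Suc k})"
      have low: "C = f (row_set k b)" if C: "up C (f ?R)" for C
      proof -
        have "C \<in> ?V" using up_in_verts[OF C] mem RV by blast
        then have "up (?g C) ?R" using up_g[of C "f ?R"] C mem RV fg by simp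
        then have "?g C = row_set k b" by (rule up_row_set_unique)
        then show ?thesis using fg by metis
      qed
      have 1: "up (insert (Suc k) (f ?R - {Suc (Suc k)})) (f ?R)"
        by (rule downI) (auto simp: E col_set_def)
      have 2: "up (insert (Suc k - b) (f ?R - {Suc (Suc k - b)})) (f ?R)"
        using b by (intro downI) (auto simp: E col_set_def)
      have "insert (Suc k) (f ?R - {Suc (Suc k)}) = insert (Suc k - b) (f ?R - {Suc (Suc k - b)})"
        using low[OF 1] low[OF 2] by (rule trans[OF _ sym])
      moreover have "k + 2 \<in> insert (Suc k - b) (f ?R - {Suc (Suc k - b)})"
        using b by (auto simp: E)
      moreover have "k + 2 \<notin> insert (Suc k) (f ?R - {Suc (Suc k)})" by simp
      ultimately show ?thesis by blast
    qed (use b in auto)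
  qed
  consider "2 * k < n" | "n < 2 * k" using k by linarith
  then show False
  proof cases
    case 1
    have RV: "row_set k k \<in> ?V" using 1 k by (intro row_set_in_verts) auto
    \<comment> \<open>The column of full height \<open>k\<close> can only be widened, whereas
      \<open>2 * k < n\<close> lets the row grow in both directions. Both covers \<open>?C\<close>
      and \<open>?D\<close> of the row thus get the same image.\<close>
    have *: "f C = insert (k + 2) (col_set k k - {Suc k})" if "up (row_set k k) C" "C \<in> ?V" for C
    proof -
      have "up (col_set k k) (f C)" using up_f[OF RV that(2)] that row[of k] 1 k by simp
      then show ?thesis by (rule up_col_setE) (use k in auto)
    qed
    let ?C = "insert (Suc (k + k)) (row_set k k - {k + k})"
    let ?D = "insert (Suc (k - 1)) (row_set k k - {k - 1})"
    have C: "up (row_set k k) ?C" "?C \<in> ?V"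
      using 1 k by (intro upI[OF RV]; auto simp: row_set_def)+
    have D: "up (row_set k k) ?D" "?D \<in> ?V"
      using 1 k by (intro upI[OF RV]; auto simp: row_set_def)+
    have "?C = ?D" using *[OF C] *[OF D] fg(1) by metis
    moreover have "k + k \<in> ?D" using k by (auto simp: row_set_def)
    moreover have "k + k \<notin> ?C" by simp
    ultimately show False by blast
  next
    case 2
    define b where "b = n - k"
    have b: "2 \<le> b" "b < k" "k + b = n" using 2 k by (auto simp: b_def)
    have RV: "row_set k b \<in> ?V" using b k by (intro row_set_in_verts) auto
    have fR: "f (row_set k b) = col_set k b" using row b by simp
    then have CV: "col_set k b \<in> ?V" using mem(1) RV by metis
    \<comment> \<open>Now the last token of the row stands at \<open>n\<close>, so only the token at
      \<open>k - 1\<close> can move. The column still has two upper covers, which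
      \<open>inv f\<close> would identify.\<close>
    have *: "?g C = insert k (row_set k b - {k - 1})" if C: "up (col_set k b) C" "C \<in> ?V" for C
    proof -
      have "up (row_set k b) (?g C)" using up_g[OF CV C(2)] C fR fg by metis
      then obtain i where i: "i \<in> row_set k b" "Suc i \<notin> row_set k b"
          "?g C = insert (Suc i) (row_set k b - {i})"
        by (auto simp: up_def)
      have "?g C \<in> ?V" using C mem by simp
      then have "Suc i \<le> n" using i(3) by (auto simp: verts_token_path)
      then have "i = k - 1" using i(1,2) b by (auto simp: row_set_def)
      then show ?thesis using i(3) k by simp
    qed
    let ?C = "insert (Suc (Suc k)) (col_set k b - {Suc k})"
    let ?D = "insert (Suc (k - b)) (col_set k b - {k - b})"
    have C: "up (col_set k b) ?C" "?C \<in> ?V"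
      using b k by (intro upI[OF CV]; auto simp: col_set_def)+
    have D: "up (col_set k b) ?D" "?D \<in> ?V"
      using b k by (intro upI[OF CV]; auto simp: col_set_def)+
    have "?C = ?D" using *[OF C] *[OF D] fg(2) by metis
    moreover have "Suc k \<in> ?D" using b k by (auto simp: col_set_def)
    moreover have "Suc k \<notin> ?C" by simp
    ultimately show False by blast
  qed
qed

lemma Aut_bottom_fixed:
  assumes f: "f \<in> Aut (token_path n k)" "f {1..k} = {1..k}" and nk: "n \<noteq> 2 * k"
    and "A \<in> verts (token_path n k)"
  shows "f A = A"
  using assms(4)
proof (induction "\<Sum>A" arbitrary: A rule: less_induct)
  case less
  let ?V = "verts (token_path n k)" and ?g = "inv f"
  show ?case
  proof (rule ccontr)
    assume ne: "f A \<noteq> A"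
    then have "A \<noteq> {1..k}" using f by auto
    then obtain B where B: "up B A" using down_exists[OF less(2)] by metis
    have fA: "f A \<in> ?V" using Aut_mem_iff[OF f(1)] less by simp
    have fix_low: "f C = C" if C: "up C A" for C
    proof -
      have "C \<in> ?V" using up_in_verts[OF C less(2)] .
      moreover have "\<Sum>C < \<Sum>A" using sum_up[OF C finite_token_path[OF calculation]] by simp
      ultimately show ?thesis using less(1) by simp
    qed
    have low: "up C (f A)" if C: "up C A" for C
      using Aut_up_iff[OF f up_in_verts[OF C less(2)] less(2)] C fix_low[OF C] by simp
    \<comment> \<open>The preimage of \<open>C\<close> lies below \<open>A\<close>, hence is fixed
      by minimality, and so equals \<open>C\<close>.\<close>
    have low': "up C A" if C: "up C (f A)" for C
    proof -
      have CV: "C \<in> ?V" using up_in_verts[OF C fA] .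
      then have "?g C \<in> ?V" using Aut_mem_iff[OF Aut_inv[OF f(1)]] by simp
      then have "up (?g C) A"
        using Aut_up_iff[OF f _ less(2), of "?g C"] C Aut_inv_f(2)[OF f(1)] by simp
      moreover from fix_low[OF this] have "C = ?g C" using Aut_inv_f(2)[OF f(1)] by simp
      ultimately show ?thesis by simp
    qed
    \<comment> \<open>Two distinct lower covers of \<open>A\<close> would also lie below
      \<open>f A\<close> and force \<open>f A = A\<close>.\<close>
    have u: "C = D" if "up C A" "up D A" for C D
      using common_upper_cover_unique[OF that low[OF that(1)] low[OF that(2)]] ne by metis
    have u': "C = D" if "up C (f A)" "up D (f A)" for C D
      using u low' that by blast
    consider "k \<ge> 2" "A = row_set k 2" "f A = col_set k 2"
      | "k \<ge> 2" "A = col_set k 2" "f A = row_set k 2"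
      using join_irreducible_pair[OF B low[OF B] ne[symmetric] less(2) u u'] by blast
    then show False
    proof cases
      case 1
      then have "k + 2 \<le> n" using less(2) by (auto simp: verts_token_path row_set_def)
      then show False using Aut_bottom_row_not_to_col[OF f] 1 nk by simp
    next
      case 2
      then have "k + 2 \<le> n" using fA by (auto simp: verts_token_path row_set_def)
      \<comment> \<open>If the column goes to the row, then \<open>inv f\<close> takes the row to
        the column.\<close>
      moreover have "?g {1..k} = {1..k}" "?g (row_set k 2) = col_set k 2"
        using Aut_inv_f(1)[OF f(1)] f(2) 2 by metis+
      ultimately show False using Aut_bottom_row_not_to_col[OF Aut_inv[OF f(1)]] 2 nk by simp
    qed
  qed
qed

section \<open>The reflection and the whole automorphism group\<close>

text \<open>Off the path it is the identity, as membership in \<open>Aut\<close> demands.\<close>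

definition reflect :: "nat \<Rightarrow> nat \<Rightarrow> nat" where
  "reflect n = (\<lambda>i. if i \<in> {1..n} then n + 1 - i else i)"

lemma reflect_reflect: "reflect n (reflect n i) = i"
  by (auto simp: reflect_def)

lemma reflect_in_Aut: "reflect n \<in> Aut (path_graph n)"
proof -
  have "bij_betw (reflect n) {1..n} {1..n}"
    by (rule bij_betw_byWitness[where f' = "reflect n"]) (auto simp: reflect_reflect, auto simp: reflect_def)
  then have "reflect n permutes {1..n}"
    by (rule bij_imp_permutes) (auto simp: reflect_def)
  moreover have "{reflect n u, reflect n v} \<in> edges (path_graph n) \<longleftrightarrow> {u, v} \<in> edges (path_graph n)"
    if "u \<in> {1..n}" "v \<in> {1..n}" for u v
    using that unfolding edge_path_graph_iff by (auto simp: reflect_def)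
  ultimately show ?thesis by (simp add: Aut_def path_graph_def)
qed

text \<open>Each token and its mirror image add up to \<open>n + 1\<close>. So the reflection
  reverses ranks and turns lower covers into upper covers.\<close>

lemma sum_reflect_image:
  assumes "A \<in> verts (token_path n k)"
  shows "\<Sum>(reflect n ` A) + \<Sum>A = k * (n + 1)"
proof -
  have A: "A \<subseteq> {1..n}" "card A = k" using assms by (auto simp: verts_token_path)
  have "inj_on (reflect n) A" by (metis inj_onI reflect_reflect)
  then have "\<Sum>(reflect n ` A) = (\<Sum>x\<in>A. reflect n x)" by (simp add: sum.reindex)
  then have "\<Sum>(reflect n ` A) + \<Sum>A = (\<Sum>x\<in>A. reflect n x + x)" by (simp add: sum.distrib)
  also have "\<dots> = (\<Sum>x\<in>A. n + 1)" using A by (intro sum.cong) (auto simp: reflect_def)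
  finally show ?thesis using A by simp
qed

theorem theorem2:
  fixes n k :: nat
  assumes "n \<ge> 2" and "1 \<le> k" and "k \<le> n - 1" and "n \<noteq> 2 * k"
  shows "(\<forall>f \<in> Aut (token_graph k (path_graph n)). \<exists>\<theta> \<in> Aut (path_graph n).
            \<forall>A \<in> verts (token_graph k (path_graph n)). f A = \<theta> ` A)
       \<and> Aut (token_graph k (path_graph n)) = induced_map k (path_graph n) ` Aut (path_graph n)
       \<and> card (Aut (token_graph k (path_graph n))) = 2"
proof -
  let ?T = "token_path n k" and ?ind = "induced_map k (path_graph n)"
  let ?V = "verts ?T"
  define r where "r = ?ind (reflect n)"
  have r_Aut: "r \<in> Aut ?T"
    unfolding r_def by (intro induced_map_in_Aut simple_graph_path_graph reflect_in_Aut)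
  have r: "r A = reflect n ` A" if "A \<in> ?V" for A using that by (simp add: r_def induced_map_def)
  have rV: "r A \<in> ?V \<longleftrightarrow> A \<in> ?V" for A by (rule Aut_mem_iff[OF r_Aut])
  have rr: "r (r A) = A" for A
  proof (cases "A \<in> ?V")
    case True
    then have "r (r A) = reflect n ` reflect n ` A" using r rV by metis
    then show ?thesis by (simp add: image_image reflect_reflect)
  next
    case False
    then show ?thesis by (simp add: r_def induced_map_def)
  qed
  have r_sum: "\<Sum>(r A) + \<Sum>A = k * (n + 1)" if "A \<in> ?V" for A
    using sum_reflect_image[OF that] r[OF that] by simp
  have bot: "{1..k} \<in> ?V" using assms by (auto simp: verts_token_path)
  \<comment> \<open>Only the last token of \<open>{1..k}\<close> can move, so the bottom has at most
    one neighbour.\<close>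
  have bot_nbr: "C = insert (Suc k) ({1..k} - {k})" if C: "C \<in> ?V" "{{1..k}, C} \<in> edges ?T" for C
  proof -
    have "\<not> up C {1..k}"
    proof
      assume "up C {1..k}"
      then obtain i where "i \<ge> 1" "{1..k} = insert (Suc i) (C - {i})" by (auto simp: up_def)
      then have "i \<ge> 1" "Suc i \<in> {1..k}" "i \<notin> {1..k}" by auto
      then show False by auto
    qed
    then have "up {1..k} C" using edge_token_path_iff[OF bot C(1)] C(2) by simp
    then obtain i where i: "i \<in> {1..k}" "Suc i \<notin> {1..k}" "C = insert (Suc i) ({1..k} - {i})"
      by (auto simp: up_def)
    then have "i = k" by auto
    then show ?thesis using i(3) by simp
  qed
  \<comment> \<open>A vertex other than the bottom and its mirror image has a lower cover
    \<open>D\<close> and an upper cover \<open>r C\<close>, where \<open>C\<close> is a lower cover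
    of the mirrored vertex. Pulled back along \<open>f\<close> they would be two neighbours of the
    bottom.\<close>
  have ends: "f {1..k} = {1..k} \<or> f {1..k} = r {1..k}" if f: "f \<in> Aut ?T" for f
  proof (rule ccontr)
    let ?A = "f {1..k}"
    assume contra: "\<not> ?thesis"
    have AV: "?A \<in> ?V" using Aut_mem_iff[OF f] bot by simp
    obtain D where D: "up D ?A" using contra down_exists[OF AV] by metis
    have "r ?A \<noteq> {1..k}" using contra rr by metis
    then obtain C where C: "up C (r ?A)" using down_exists[of "r ?A" k n] AV rV by metis
    have V: "D \<in> ?V" "C \<in> ?V" using up_in_verts D C AV rV by blast+
    have "\<Sum>?A = Suc (\<Sum>D)" "\<Sum>(r ?A) = Suc (\<Sum>C)"
      using sum_up D C V finite_token_path by blast+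
    \<comment> \<open>The ranks of \<open>D\<close> and \<open>r C\<close> lie one below and one
      above that of \<open>?A\<close>.\<close>
    then have ne: "D \<noteq> r C" using r_sum[OF V(2)] r_sum[OF AV] by auto
    have "{?A, D} \<in> edges ?T" using D edge_token_path_iff[OF AV V(1)] by simp
    moreover have "{r ?A, C} \<in> edges ?T" using C edge_token_path_iff[of "r ?A" k n C] AV V rV by simp
    then have "{?A, r C} \<in> edges ?T"
      using Aut_edge_iff[OF r_Aut, of ?A "r C"] AV V rV rr by simp
    moreover have "{{1..k}, inv f E} \<in> edges ?T" "inv f E \<in> ?V" if "{?A, E} \<in> edges ?T" "E \<in> ?V" for E
      using Aut_edge_iff[OF Aut_inv[OF f] AV that(2)] Aut_mem_iff[OF Aut_inv[OF f]] that
        Aut_inv_f(1)[OF f] by simp_all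
    ultimately have "inv f D = inv f (r C)" using bot_nbr V rV by metis
    then show False using ne Aut_inv_f(2)[OF f] by metis
  qed
  have fixed: "f = id" if f: "f \<in> Aut ?T" "f {1..k} = {1..k}" for f
  proof
    fix A
    show "f A = id A"
    proof (cases "A \<in> ?V")
      case True
      then show ?thesis using Aut_bottom_fixed[OF f assms(4)] by simp
    next
      case False
      then show ?thesis using f by (auto simp: Aut_def permutes_def)
    qed
  qed
  have "f = id \<or> f = r" if f: "f \<in> Aut ?T" for f
    using ends[OF f]
  proof
    assume "f {1..k} = r {1..k}"
    then have "r \<circ> f = id" using fixed[OF Aut_comp[OF r_Aut f]] rr by simp
    then have "f = r" by (metis comp_apply eq_id_iff ext rr)
    then show ?thesis ..
  qed (use fixed f in blast)
  then have Aut: "Aut ?T = {id, r}" using id_in_Aut r_Aut by blast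
  have "id = ?ind id" by (simp add: induced_map_def fun_eq_iff)
  then have "id \<in> ?ind ` Aut (path_graph n)" using id_in_Aut by (rule image_eqI)
  moreover have "r \<in> ?ind ` Aut (path_graph n)" using r_def reflect_in_Aut by (rule image_eqI)
  ultimately have "Aut ?T \<subseteq> ?ind ` Aut (path_graph n)" by (simp add: Aut)
  moreover have "?ind ` Aut (path_graph n) \<subseteq> Aut ?T"
    using induced_map_in_Aut[OF simple_graph_path_graph] by blast
  ultimately have eq: "Aut ?T = ?ind ` Aut (path_graph n)" by (rule subset_antisym)
  \<comment> \<open>The token reflected to \<open>1\<close> would stand at \<open>n\<close>, which
    exceeds \<open>k\<close>.\<close>
  have "1 \<notin> r {1..k}" using assms unfolding r[OF bot] by (auto simp: reflect_def)
  moreover have "1 \<in> {1..k}" using assms by simp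
  ultimately have "r \<noteq> id" by auto
  then have "card (Aut ?T) = 2" using Aut by simp
  moreover have "\<forall>f \<in> Aut ?T. \<exists>\<theta> \<in> Aut (path_graph n). \<forall>A \<in> ?V. f A = \<theta> ` A"
    unfolding eq by (auto simp: induced_map_def)
  ultimately show ?thesis using eq by blast
qed

end
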